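(* Let $G$ be a finitely $L$-presented group and let $H\le G$ be a subgroup of finite index. Then $H$ is finitely $L$-presented.
   Context: A finite $L$-presentation $\langle \mathcal X\mid\mathcal Q\mid\Phi\mid\mathcal R\rangle$ consists of a finite alphabet $\mathcal X$, finite subsets $\mathcal Q,\mathcal R$ of the free group $F$ over $\mathcal X$, and a finite set $\Phi$ of endomorphisms of $F$. Let $\Phi^*$ denote the monoid of endomorphisms of $F$ generated by $\Phi$ (including the identity). The finite $L$-presentation stands for the (possibly infinite) group presentation $\langle \mathcal X\mid \mathcal Q\cup\bigcup_{\sigma\in\Phi^*}\mathcal R^\sigma\rangle$, i.e. it defines the group $F/K$ with $K$ the normal closure of $\mathcal Q\cup\bigcup_{\sigma\in\Phi^*}\mathcal R^\sigma$ in $F$, where $\mathcal R^\sigma=\{r^\sigma : r\in\mathcal R\}$ and $r^\sigma$ is the image of $r$ under $\sigma$. A group is finitely $L$-presented if it is isomorphic to a group defined by some finite $L$-presentation. *)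

theory Defs
  imports "HOL-Algebra.Generated_Groups"
begin

section \<open>Free groups\<close>

text \<open>
  The free group over an alphabet \<open>X\<close> is realised by its reduced words. The letter \<open>(x, True)\<close>
  stands for the generator \<open>x\<close> and \<open>(x, False)\<close> for its formal inverse.
\<close>

type_synonym 'x letter = "'x \<times> bool"

definition letter_inv :: "'x letter \<Rightarrow> 'x letter" where
  "letter_inv a = (fst a, \<not> snd a)"

definition reduced :: "'x letter list \<Rightarrow> bool" where
  "reduced w \<longleftrightarrow> successively (\<lambda>a b. b \<noteq> letter_inv a) w"

fun cancel_Cons :: "'x letter \<Rightarrow> 'x letter list \<Rightarrow> 'x letter list" where
  "cancel_Cons a [] = [a]"
| "cancel_Cons a (b # w) = (if b = letter_inv a then w else a # b # w)"

definition reduce :: "'x letter list \<Rightarrow> 'x letter list" where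
  "reduce w = foldr cancel_Cons w []"

definition free_group :: "'x set \<Rightarrow> 'x letter list monoid" where
  "free_group X =
     \<lparr>carrier = {w. fst ` set w \<subseteq> X \<and> reduced w}, mult = (\<lambda>u v. reduce (u @ v)), one = []\<rparr>"

lemma letter_inv_letter_inv [simp]: "letter_inv (letter_inv a) = a"
  by (simp add: letter_inv_def)

lemma fst_letter_inv [simp]: "fst (letter_inv a) = fst a"
  by (simp add: letter_inv_def)

lemma letter_inv_neq [simp]: "letter_inv a \<noteq> a" "a \<noteq> letter_inv a"
  by (auto simp: letter_inv_def prod_eq_iff)

lemma reduced_Nil [simp]: "reduced []"
  by (simp add: reduced_def)

lemma reduced_tl: "reduced (a # w) \<Longrightarrow> reduced w"
  by (cases w) (auto simp: reduced_def)

lemma reduced_cancel_Cons: "reduced w \<Longrightarrow> reduced (cancel_Cons a w)"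
  by (cases w) (auto simp: reduced_def successively_Cons)

lemma reduced_foldr_cancel_Cons: "reduced v \<Longrightarrow> reduced (foldr cancel_Cons u v)"
  by (induction u) (auto simp: reduced_cancel_Cons)

lemma reduced_reduce [simp]: "reduced (reduce w)"
  by (simp add: reduce_def reduced_foldr_cancel_Cons)

lemma reduce_reduced: "reduced w \<Longrightarrow> reduce w = w"
proof (induction w)
  case (Cons a w)
  then have "reduce w = w"
    using reduced_tl by blast
  then have "reduce (a # w) = cancel_Cons a w"
    by (simp add: reduce_def)
  then show ?case
    using Cons.prems by (cases w) (auto simp: reduced_def)
qed (simp add: reduce_def)

lemma cancel_Cons_letter_inv:
  "reduced w \<Longrightarrow> cancel_Cons (letter_inv a) (cancel_Cons a w) = w"
  by (cases w rule: remdups_adj.cases) (auto simp: reduced_def successively_Cons)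

lemma foldr_cancel_Cons_cancel_Cons:
  assumes "reduced w"
  shows "foldr cancel_Cons (cancel_Cons a r) w = cancel_Cons a (foldr cancel_Cons r w)"
proof (cases r)
  case (Cons b v)
  have "cancel_Cons a (cancel_Cons (letter_inv a) (foldr cancel_Cons v w)) = foldr cancel_Cons v w"
    using cancel_Cons_letter_inv[of "foldr cancel_Cons v w" "letter_inv a"] assms
    by (simp add: reduced_foldr_cancel_Cons)
  then show ?thesis
    using Cons by simp
qed simp

lemma foldr_cancel_Cons_reduce:
  "reduced w \<Longrightarrow> foldr cancel_Cons (reduce u) w = foldr cancel_Cons u w"
  by (induction u) (simp_all add: reduce_def foldr_cancel_Cons_cancel_Cons)

lemma reduce_append: "reduce (u @ v) = foldr cancel_Cons u (reduce v)"
  by (simp add: reduce_def)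

lemma reduce_append_reduce_left: "reduce (reduce u @ v) = reduce (u @ v)"
  by (simp add: reduce_append foldr_cancel_Cons_reduce)

lemma reduce_append_reduce_right: "reduce (u @ reduce v) = reduce (u @ v)"
  by (simp add: reduce_append reduce_reduced)

lemma set_cancel_Cons_subset: "set (cancel_Cons a w) \<subseteq> insert a (set w)"
  by (cases w) auto

lemma set_reduce_subset: "set (reduce w) \<subseteq> set w"
proof (induction w)
  case (Cons a w)
  then show ?case
    using set_cancel_Cons_subset[of a "reduce w"] by (auto simp: reduce_def)
qed (simp add: reduce_def)

lemma reduce_inverse_word: "reduce (rev (map letter_inv w) @ w) = []"
proof (induction w)
  case (Cons a w)
  have "reduce (rev (map letter_inv (a # w)) @ (a # w))
      = foldr cancel_Cons (rev (map letter_inv w))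
          (cancel_Cons (letter_inv a) (cancel_Cons a (reduce w)))"
    by (simp add: reduce_def)
  also have "\<dots> = reduce (rev (map letter_inv w) @ w)"
    by (simp add: cancel_Cons_letter_inv reduce_append)
  finally show ?case
    using Cons by simp
qed (simp add: reduce_def)

lemma group_free_group: "group (free_group X)"
proof (rule groupI)
  fix u v assume "u \<in> carrier (free_group X)" "v \<in> carrier (free_group X)"
  then show "u \<otimes>\<^bsub>free_group X\<^esub> v \<in> carrier (free_group X)"
    using set_reduce_subset[of "u @ v"] by (fastforce simp: free_group_def)
next
  fix u assume u: "u \<in> carrier (free_group X)"
  show "\<exists>v\<in>carrier (free_group X). v \<otimes>\<^bsub>free_group X\<^esub> u = \<one>\<^bsub>free_group X\<^esub>"
  proof
    show "reduce (rev (map letter_inv u)) \<in> carrier (free_group X)"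
      using u set_reduce_subset[of "rev (map letter_inv u)"] by (fastforce simp: free_group_def)
    show "reduce (rev (map letter_inv u)) \<otimes>\<^bsub>free_group X\<^esub> u = \<one>\<^bsub>free_group X\<^esub>"
      by (simp add: free_group_def reduce_append_reduce_left reduce_inverse_word)
  qed
qed (auto simp: free_group_def reduce_append_reduce_left reduce_append_reduce_right reduce_reduced)


section \<open>Finite L-presentations\<close>

definition normal_closure :: "('a, 'b) monoid_scheme \<Rightarrow> 'a set \<Rightarrow> 'a set" where
  "normal_closure G S = \<Inter>{N. N \<lhd> G \<and> S \<subseteq> N}"

lemma (in group) normal_normal_closure:
  assumes "S \<subseteq> carrier G"
  shows "normal_closure G S \<lhd> G"
proof -
  have self: "carrier G \<lhd> G"
    by (rule normal_invI) (auto simp: subgroup_self)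
  have "subgroup (normal_closure G S) G"
    unfolding normal_closure_def
    by (rule subgroups_Inter) (use self assms normal_imp_subgroup in auto)
  then show ?thesis
    by (rule normal_invI) (auto simp: normal_closure_def intro: normal.inv_op_closed2)
qed

inductive_set endo_monoid :: "('a \<Rightarrow> 'a) set \<Rightarrow> ('a \<Rightarrow> 'a) set" for \<Phi> where
  id: "id \<in> endo_monoid \<Phi>"
| incl: "\<phi> \<in> \<Phi> \<Longrightarrow> \<phi> \<in> endo_monoid \<Phi>"
| comp: "\<sigma> \<in> endo_monoid \<Phi> \<Longrightarrow> \<tau> \<in> endo_monoid \<Phi> \<Longrightarrow> \<sigma> \<circ> \<tau> \<in> endo_monoid \<Phi>"

definition finite_L_presentation ::
  "'x set \<Rightarrow> 'x letter list set \<Rightarrow> ('x letter list \<Rightarrow> 'x letter list) set \<Rightarrow> 'x letter list set \<Rightarrow> bool"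
where
  "finite_L_presentation X Q \<Phi> R \<longleftrightarrow>
     finite X \<and>
     finite Q \<and> Q \<subseteq> carrier (free_group X) \<and>
     finite \<Phi> \<and> \<Phi> \<subseteq> hom (free_group X) (free_group X) \<and>
     finite R \<and> R \<subseteq> carrier (free_group X)"

definition L_presented_group ::
  "'x set \<Rightarrow> 'x letter list set \<Rightarrow> ('x letter list \<Rightarrow> 'x letter list) set \<Rightarrow> 'x letter list set
     \<Rightarrow> 'x letter list set monoid"
where
  "L_presented_group X Q \<Phi> R =
     free_group X Mod normal_closure (free_group X) (Q \<union> (\<Union>\<sigma>\<in>endo_monoid \<Phi>. \<sigma> ` R))"

text \<open>
  A definition in HOL cannot quantify over the type of the letters. Since the alphabet is finite,
  its letters may be renamed, so alphabets of natural numbers give all finite \<open>L\<close>-presentations.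
\<close>

definition finitely_L_presented :: "('a, 'b) monoid_scheme \<Rightarrow> bool" where
  "finitely_L_presented G \<longleftrightarrow>
     (\<exists>(X :: nat set) Q \<Phi> R. finite_L_presentation X Q \<Phi> R \<and> G \<cong> L_presented_group X Q \<Phi> R)"

end

theory Submission
  imports Defs "HOL-Library.Countable_Set"
begin

text \<open>
  Write \<open>G = F/K\<close> and let \<open>\<Omega>\<close> be the finite set of right cosets of \<open>H\<close>. The endomorphisms in \<open>\<Phi>\<close>
  need not respect the preimage of \<open>H\<close> in \<open>F\<close>, but they act by pullback on the finite set \<open>S\<close> of all
  actions of \<open>F\<close> on \<open>\<Omega>\<close>. Take as new alphabet the edges \<open>(s, i, x)\<close> of the Schreier graphs of all
  \<open>s \<in> S\<close>, and let \<open>\<rho> s i w\<close> be the word read along the path labelled \<open>w\<close> that starts at \<open>i\<close>. For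
  \<open>\<delta> \<in> \<Phi>\<close> and \<open>s \<in> S\<close> the endomorphism that sends \<open>(\<delta>\<^sup>* s, i, x)\<close> to \<open>\<rho> s i (\<delta> x)\<close> and all edges of
  the other graphs to \<open>1\<close> maps \<open>\<rho> (\<delta>\<^sup>* s) i w\<close> to \<open>\<rho> s i (\<delta> w)\<close>. Hence the relators \<open>\<rho> s i r\<close>
  generate under these endomorphisms all \<open>\<rho> b i (\<sigma> r)\<close>, where \<open>b\<close> is the action on the cosets. Killing
  the edges of the other graphs, the words \<open>\<rho> b i q\<close>, and the paths from \<open>H\<close> along a transversal
  leaves the group \<open>H\<close>, as in the Reidemeister-Schreier theorem.
\<close>

section \<open>Homomorphisms from free groups\<close>

lemma free_group_simps [simp]:
  "w \<in> carrier (free_group X) \<longleftrightarrow> fst ` set w \<subseteq> X \<and> reduced w"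
  "u \<otimes>\<^bsub>free_group X\<^esub> v = reduce (u @ v)"
  "\<one>\<^bsub>free_group X\<^esub> = []"
  by (auto simp: free_group_def)

lemma reduced_singleton [simp]: "reduced [a]"
  by (simp add: reduced_def)

lemma fst_set_reduce_subset: "fst ` set w \<subseteq> X \<Longrightarrow> fst ` set (reduce w) \<subseteq> X"
  using set_reduce_subset by fast

lemma reduce_Nil [simp]: "reduce [] = []"
  by (simp add: reduce_def)

lemma reduce_Cons: "reduce (a # w) = cancel_Cons a (reduce w)"
  by (simp add: reduce_def)

text \<open>Evaluation is defined on arbitrary words, not only on reduced ones: it is then
  multiplicative for plain concatenation, and invariance under \<open>reduce\<close> can be proved
  separately.\<close>

definition word_value :: "('a, 'b) monoid_scheme \<Rightarrow> ('x \<Rightarrow> 'a) \<Rightarrow> 'x letter list \<Rightarrow> 'a" where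
  "word_value G g w =
     foldr (\<lambda>a p. (if snd a then g (fst a) else inv\<^bsub>G\<^esub> g (fst a)) \<otimes>\<^bsub>G\<^esub> p) w \<one>\<^bsub>G\<^esub>"

context group
begin

lemma word_value_Nil [simp]: "word_value G g [] = \<one>"
  by (simp add: word_value_def)

lemma word_value_Cons:
  "word_value G g (a # w) = (if snd a then g (fst a) else inv g (fst a)) \<otimes> word_value G g w"
  by (simp add: word_value_def)

lemma word_value_closed:
  "g \<in> X \<rightarrow> carrier G \<Longrightarrow> fst ` set w \<subseteq> X \<Longrightarrow> word_value G g w \<in> carrier G"
  by (induction w) (auto simp: word_value_Cons)

lemma word_value_append:
  assumes "g \<in> X \<rightarrow> carrier G" "fst ` set u \<subseteq> X" "fst ` set v \<subseteq> X"
  shows "word_value G g (u @ v) = word_value G g u \<otimes> word_value G g v"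
  using assms(2)
proof (induction u)
  case Nil
  then show ?case
    using word_value_closed[OF assms(1,3)] by simp
next
  case (Cons a u)
  then have "g (fst a) \<in> carrier G" "word_value G g u \<in> carrier G" "word_value G g v \<in> carrier G"
    using assms word_value_closed by auto
  then show ?case
    using Cons by (auto simp: word_value_Cons m_assoc)
qed

lemma word_value_cancel_Cons:
  assumes "g \<in> X \<rightarrow> carrier G" "fst a \<in> X" "fst ` set w \<subseteq> X"
  shows "word_value G g (cancel_Cons a w) = word_value G g (a # w)"
proof (cases w)
  case (Cons b v)
  then have "g (fst a) \<in> carrier G" "word_value G g v \<in> carrier G"
    using assms word_value_closed by auto
  then show ?thesis
    using Cons by (auto simp: word_value_Cons letter_inv_def m_assoc[symmetric])
qed simp

lemma word_value_reduce:
  assumes "g \<in> X \<rightarrow> carrier G"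
  shows "fst ` set w \<subseteq> X \<Longrightarrow> word_value G g (reduce w) = word_value G g w"
proof (induction w)
  case (Cons a w)
  then show ?case
    using word_value_cancel_Cons[OF assms, of a "reduce w"] fst_set_reduce_subset[of w X]
    by (simp add: reduce_Cons word_value_Cons)
qed simp

text \<open>The existence half of the universal property of free groups; it combines
  multiplicativity on concatenations with invariance under free reduction.\<close>

lemma word_value_hom:
  "g \<in> X \<rightarrow> carrier G \<Longrightarrow> word_value G g \<in> hom (free_group X) G"
  by (intro homI)
    (auto simp: word_value_closed word_value_reduce[of g X] word_value_append[of g X] image_Un)

end

lemma hom_free_group_reduce_append:
  assumes "h \<in> hom (free_group X) (free_group Y)"
    and "fst ` set u \<subseteq> X" "reduced u" "fst ` set v \<subseteq> X" "reduced v"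
  shows "h (reduce (u @ v)) = reduce (h u @ h v)"
  using hom_mult[OF assms(1), of u v] assms by simp

lemma hom_free_group_Nil:
  assumes "h \<in> hom (free_group X) (free_group Y)"
  shows "h [] = []"
  using hom_one[OF assms] by (simp add: group_free_group)

lemma endo_monoid_hom:
  assumes "\<Phi> \<subseteq> hom G G" "\<sigma> \<in> endo_monoid \<Phi>"
  shows "\<sigma> \<in> hom G G"
  using assms(2)
proof induction
  case id
  then show ?case
    by (auto simp: hom_def)
next
  case (comp \<sigma> \<tau>)
  then show ?case
    using hom_compose by blast
qed (use assms(1) in auto)

lemma L_relators_closed:
  assumes "Q \<subseteq> carrier G" "R \<subseteq> carrier G" "\<Phi> \<subseteq> hom G G"
  shows "Q \<union> (\<Union>\<sigma>\<in>endo_monoid \<Phi>. \<sigma> ` R) \<subseteq> carrier G"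
proof -
  have "\<sigma> r \<in> carrier G" if "\<sigma> \<in> endo_monoid \<Phi>" "r \<in> R" for \<sigma> r
    using hom_in_carrier[OF endo_monoid_hom[OF assms(3) that(1)] subsetD[OF assms(2) that(2)]] .
  then show ?thesis
    using assms(1) by blast
qed

lemma normal_closure_subset: "N \<lhd> G \<Longrightarrow> S \<subseteq> N \<Longrightarrow> normal_closure G S \<subseteq> N"
  by (auto simp: normal_closure_def)

lemma subset_normal_closure: "S \<subseteq> normal_closure G S"
  by (auto simp: normal_closure_def)


section \<open>Actions of free groups\<close>

text \<open>
  A right action of the free group on \<open>\<Omega>\<close> is given by the action of the letters; the word \<open>w\<close> moves
  the point \<open>i\<close> to \<open>foldl s i w\<close>. Outside of \<open>\<Omega>\<close> and \<open>X\<close> all actions are trivial, so that there are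
  only finitely many of them.
\<close>

definition letter_actions :: "'p set \<Rightarrow> 'x set \<Rightarrow> ('p \<Rightarrow> 'x letter \<Rightarrow> 'p) set" where
  "letter_actions \<Omega> X =
     {s. (\<forall>i a. s (s i a) (letter_inv a) = i) \<and> (\<forall>i\<in>\<Omega>. \<forall>a. s i a \<in> \<Omega>) \<and>
         (\<forall>i a. i \<notin> \<Omega> \<or> fst a \<notin> X \<longrightarrow> s i a = i)}"

definition letter_action :: "'p set \<Rightarrow> 'x set \<Rightarrow> ('p \<Rightarrow> 'x letter list \<Rightarrow> 'p) \<Rightarrow> 'p \<Rightarrow> 'x letter \<Rightarrow> 'p"
  where "letter_action \<Omega> X m i a = (if i \<in> \<Omega> \<and> fst a \<in> X then m i [a] else i)"

lemma letter_actionsD: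
  assumes "s \<in> letter_actions \<Omega> X"
  shows "s (s i a) (letter_inv a) = i" "i \<in> \<Omega> \<Longrightarrow> s i a \<in> \<Omega>"
    "i \<notin> \<Omega> \<or> fst a \<notin> X \<Longrightarrow> s i a = i"
  using assms by (simp_all add: letter_actions_def del: split_paired_All)

text \<open>Triviality outside of \<Omega> and \<open>X\<close> makes an action recoverable from its
  restriction to the finite set of pairs of a point and a letter over \<open>X\<close>, and there
  are only finitely many maps from that set to \<Omega>.\<close>

lemma finite_letter_actions:
  assumes "finite \<Omega>" "finite X"
  shows "finite (letter_actions \<Omega> X)"
proof (rule inj_on_finite)
  let ?A = "\<Omega> \<times> (X \<times> (UNIV :: bool set))"
  let ?f = "\<lambda>s. restrict (\<lambda>(i, a). s i a) ?A"
  show "inj_on ?f (letter_actions \<Omega> X)"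
  proof (intro inj_onI ext)
    fix s t i a
    assume st: "s \<in> letter_actions \<Omega> X" "t \<in> letter_actions \<Omega> X" and eq: "?f s = ?f t"
    show "s i a = t i a"
    proof (cases "i \<in> \<Omega> \<and> fst a \<in> X")
      case True
      then show ?thesis
        using fun_cong[OF eq, of "(i, a)"] by (simp add: mem_Times_iff)
    next
      case False
      then show ?thesis
        using st[THEN letter_actionsD(3), of i a] by simp
    qed
  qed
  show "?f ` letter_actions \<Omega> X \<subseteq> ?A \<rightarrow>\<^sub>E \<Omega>"
  proof (rule image_subsetI, rule PiE_I)
    fix s p assume "s \<in> letter_actions \<Omega> X" "p \<in> ?A"
    then show "?f s p \<in> \<Omega>"
      using letter_actionsD(2) by (cases p) fastforce
  qed (simp only: restrict_def if_False)
  show "finite (?A \<rightarrow>\<^sub>E \<Omega>)"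
    using assms by (intro finite_PiE) auto
qed

lemma foldl_action_closed:
  "s \<in> letter_actions \<Omega> X \<Longrightarrow> i \<in> \<Omega> \<Longrightarrow> foldl s i w \<in> \<Omega>"
  by (induction w arbitrary: i) (auto simp: letter_actionsD)

lemma foldl_action_cancel_Cons:
  "s \<in> letter_actions \<Omega> X \<Longrightarrow> foldl s i (cancel_Cons a w) = foldl s (s i a) w"
  by (cases w) (auto simp: letter_actionsD)

lemma foldl_action_reduce:
  "s \<in> letter_actions \<Omega> X \<Longrightarrow> foldl s i (reduce w) = foldl s i w"
  by (induction w arbitrary: i) (auto simp: reduce_Cons foldl_action_cancel_Cons)

text \<open>An action \<open>m\<close> of the group is recovered from its letters: a reduced word
  \<open>a # w\<close> is the group product of \<open>[a]\<close> and \<open>w\<close>, so induction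
  on the word applies.\<close>

lemma
  assumes closed: "\<And>i u. i \<in> \<Omega> \<Longrightarrow> u \<in> carrier (free_group X) \<Longrightarrow> m i u \<in> \<Omega>"
    and one: "\<And>i. i \<in> \<Omega> \<Longrightarrow> m i [] = i"
    and mult: "\<And>i u v. i \<in> \<Omega> \<Longrightarrow> u \<in> carrier (free_group X) \<Longrightarrow> v \<in> carrier (free_group X)
                 \<Longrightarrow> m i (reduce (u @ v)) = m (m i u) v"
  shows letter_action_in_letter_actions: "letter_action \<Omega> X m \<in> letter_actions \<Omega> X"
    and foldl_letter_action:
      "i \<in> \<Omega> \<Longrightarrow> w \<in> carrier (free_group X) \<Longrightarrow> foldl (letter_action \<Omega> X m) i w = m i w"
proof -
  have "m (m i [a]) [letter_inv a] = i" if "i \<in> \<Omega>" "fst a \<in> X" for i a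
    using mult[of i "[a]" "[letter_inv a]"] one[of i] that by (simp add: reduce_def)
  then show "letter_action \<Omega> X m \<in> letter_actions \<Omega> X"
    using closed by (auto simp: letter_actions_def letter_action_def)
  show "foldl (letter_action \<Omega> X m) i w = m i w" if "i \<in> \<Omega>" "w \<in> carrier (free_group X)"
    using that
  proof (induction w arbitrary: i)
    case (Cons a w)
    then have "reduced w" "reduce (a # w) = a # w"
      using reduced_tl[of a w] reduce_reduced[of "a # w"] by auto
    then show ?case
      using Cons closed[of i "[a]"] mult[of i "[a]" w] by (simp add: letter_action_def)
  qed (simp add: one)
qed

text \<open>The point set stays fixed and only the action is twisted, so all iterated pullbacks
  along endomorphisms stay within one finite set.\<close>

definition pullback ::
  "'p set \<Rightarrow> 'x set \<Rightarrow> ('x letter list \<Rightarrow> 'x letter list) \<Rightarrow> ('p \<Rightarrow> 'x letter \<Rightarrow> 'p) \<Rightarrow> 'p \<Rightarrow> 'x letter \<Rightarrow> 'p"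
  where "pullback \<Omega> X \<delta> s = letter_action \<Omega> X (\<lambda>i u. foldl s i (\<delta> u))"

text \<open>An endomorphism turns reduced products into reduced products, and \<open>foldl s\<close>
  does not see free reduction; hence twisting by \<delta> gives an action again.\<close>

lemma
  assumes "s \<in> letter_actions \<Omega> X" "\<delta> \<in> hom (free_group X) (free_group X)"
  shows pullback_in_letter_actions: "pullback \<Omega> X \<delta> s \<in> letter_actions \<Omega> X"
    and foldl_pullback:
      "i \<in> \<Omega> \<Longrightarrow> w \<in> carrier (free_group X) \<Longrightarrow> foldl (pullback \<Omega> X \<delta> s) i w = foldl s i (\<delta> w)"
  unfolding pullback_def
  using assms
  by (auto intro!: letter_action_in_letter_actions foldl_letter_action
      simp: foldl_action_closed foldl_action_reduce hom_free_group_Nil hom_free_group_reduce_append)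


section \<open>Paths in Schreier graphs\<close>

text \<open>\<open>e i x\<close> names the edge that leaves \<open>i\<close> with label
  \<open>x\<close>. An inverse letter traverses an edge backwards, so that edge is named after the
  point \<open>s i a\<close> that is reached, not after \<open>i\<close>.\<close>

fun edge_path :: "('p \<Rightarrow> 'x \<Rightarrow> 'y) \<Rightarrow> ('p \<Rightarrow> 'x letter \<Rightarrow> 'p) \<Rightarrow> 'p \<Rightarrow> 'x letter list \<Rightarrow> 'y letter list" where
  "edge_path e s i [] = []"
| "edge_path e s i (a # w) =
     (e (if snd a then i else s i a) (fst a), snd a) # edge_path e s (s i a) w"

lemma edge_path_append: "edge_path e s i (u @ v) = edge_path e s i u @ edge_path e s (foldl s i u) v"
  by (induction u arbitrary: i) auto

lemma edge_path_letters:
  assumes "s \<in> letter_actions \<Omega> X" "i \<in> \<Omega>" "fst ` set w \<subseteq> X"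
  shows "fst ` set (edge_path e s i w) \<subseteq> case_prod e ` (\<Omega> \<times> X)"
  using assms(2,3)
  by (induction w arbitrary: i) (use letter_actionsD(2)[OF assms(1)] in auto)

text \<open>The letters \<open>a\<close> and \<open>letter_inv a\<close> traverse the same edge in
  opposite directions, so a cancellation in the word gives a cancellation in the path.\<close>

lemma reduce_edge_path_cancel_Cons:
  assumes "s \<in> letter_actions \<Omega> X"
  shows "reduce (edge_path e s i (cancel_Cons a w)) = reduce (edge_path e s i (a # w))"
proof (cases w)
  case (Cons b v)
  show ?thesis
  proof (cases "b = letter_inv a")
    case True
    let ?l = "(e (if snd a then i else s i a) (fst a), snd a)"
    have "edge_path e s i (a # w) = ?l # letter_inv ?l # edge_path e s i v"
      using Cons True letter_actionsD(1)[OF assms, of i a] by (auto simp: letter_inv_def)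
    then show ?thesis
      using Cons True cancel_Cons_letter_inv[of "reduce (edge_path e s i v)" "letter_inv ?l"]
      by (simp add: reduce_Cons)
  qed (use Cons in simp)
qed simp

lemma reduce_edge_path_reduce:
  assumes "s \<in> letter_actions \<Omega> X"
  shows "reduce (edge_path e s i (reduce w)) = reduce (edge_path e s i w)"
proof (induction w arbitrary: i)
  case (Cons a w)
  then show ?case
    by (simp add: reduce_Cons reduce_edge_path_cancel_Cons[OF assms])
qed simp

text \<open>The cocycle identity for reduced edge paths: the path of \<open>v\<close> starts where
  the path of \<open>u\<close> ends.\<close>

lemma reduce_edge_path_mult:
  assumes "s \<in> letter_actions \<Omega> X"
  shows "reduce (edge_path e s i (reduce (u @ v))) =
    reduce (reduce (edge_path e s i u) @ reduce (edge_path e s (foldl s i u) v))"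
  by (simp add: reduce_edge_path_reduce[OF assms] edge_path_append
      reduce_append_reduce_left reduce_append_reduce_right)

text \<open>Edge paths are the universal cocycle for the action \<open>s\<close>.\<close>

lemma (in group) word_value_edge_path:
  assumes s: "s \<in> letter_actions \<Omega> X"
    and closed: "\<And>i w. i \<in> \<Omega> \<Longrightarrow> w \<in> carrier (free_group X) \<Longrightarrow> c i w \<in> carrier G"
    and cocycle: "\<And>i u v. i \<in> \<Omega> \<Longrightarrow> u \<in> carrier (free_group X) \<Longrightarrow> v \<in> carrier (free_group X)
                    \<Longrightarrow> c i (reduce (u @ v)) = c i u \<otimes> c (foldl s i u) v"
    and g: "\<And>i x. i \<in> \<Omega> \<Longrightarrow> x \<in> X \<Longrightarrow> g (e i x) = c i [(x, True)]"
    and i: "i \<in> \<Omega>" and w: "w \<in> carrier (free_group X)"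
  shows "word_value G g (reduce (edge_path e s i w)) = c i w"
proof -
  \<comment> \<open>Two empty words in the cocycle identity make \<open>c j []\<close>
    idempotent.\<close>
  have one: "c j [] = \<one>" if "j \<in> \<Omega>" for j
    using cocycle[of j "[]" "[]"] closed[of j "[]"] that by simp
  have letter: "(if snd a then g (e j (fst a)) else inv g (e (s j a) (fst a))) = c j [a]"
    if "j \<in> \<Omega>" "fst a \<in> X" for j a
  proof (cases "snd a")
    case True
    then show ?thesis
      using g[of j "fst a"] that by (cases a) auto
  next
    case False
    have sj: "s j a \<in> \<Omega>"
      using letter_actionsD(2)[OF s] that by auto
    \<comment> \<open>The cocycle identity for \<open>a\<close> followed by its inverse forces the
      value on an inverse letter.\<close>
    have "c j [a] \<otimes> c (s j a) [letter_inv a] = \<one>"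
      using cocycle[of j "[a]" "[letter_inv a]"] one[of j] that by (simp add: reduce_def)
    then have "inv c (s j a) [letter_inv a] = c j [a]"
      using inv_equality closed[of j "[a]"] closed[of "s j a" "[letter_inv a]"] sj that by simp
    then show ?thesis
      using False g[OF sj that(2)] by (cases a) (auto simp: letter_inv_def)
  qed
  have "word_value G g (edge_path e s i w) = c i w"
    using i w
  proof (induction w arbitrary: i)
    case (Cons a w)
    then have "reduced w" "reduce (a # w) = a # w"
      using reduced_tl[of a w] reduce_reduced[of "a # w"] by auto
    moreover have "s i a \<in> \<Omega>"
      using letter_actionsD(2)[OF s] Cons.prems by auto
    ultimately show ?case
      using Cons.IH[of "s i a"] Cons.prems letter[of i a] cocycle[of i "[a]" w]
      by (auto simp: word_value_Cons)
  qed (simp add: one)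
  moreover have "g \<in> case_prod e ` (\<Omega> \<times> X) \<rightarrow> carrier G"
    using g closed by auto
  ultimately show ?thesis
    using word_value_reduce[of g "case_prod e ` (\<Omega> \<times> X)"] edge_path_letters[OF s i, of w e] w
    by simp
qed


section \<open>The presentation of the subgroup\<close>

text \<open>Lifts compose along pullbacks: a lift of \<sigma> that ends in the graph of
  \<open>t\<close> starts in the graph of some \<open>s1\<close>, and the lift of \<tau> is then
  chosen to end there. In this way the rewriting of every iterated relator is reached by the new
  endomorphisms.\<close>

lemma endo_monoid_lift_exists:
  assumes \<Phi>': "\<Phi>' = (\<lambda>(\<delta>, t). \<Delta> \<delta> t) ` (\<Phi> \<times> S)"
    and \<Phi>: "\<Phi> \<subseteq> hom F F"
    and pull: "\<And>\<delta> t. \<delta> \<in> \<Phi> \<Longrightarrow> t \<in> S \<Longrightarrow> P \<delta> t \<in> S"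
    and same: "\<And>\<delta> t i w. \<delta> \<in> \<Phi> \<Longrightarrow> t \<in> S \<Longrightarrow> i \<in> \<Omega> \<Longrightarrow> w \<in> carrier F \<Longrightarrow>
                 \<Delta> \<delta> t (\<rho> (P \<delta> t) i w) = \<rho> t i (\<delta> w)"
    and "\<sigma> \<in> endo_monoid \<Phi>" "t \<in> S"
  shows "\<exists>s\<in>S. \<exists>\<sigma>'\<in>endo_monoid \<Phi>'. \<forall>i\<in>\<Omega>. \<forall>w\<in>carrier F. \<sigma>' (\<rho> s i w) = \<rho> t i (\<sigma> w)"
  using assms(5,6)
proof (induction arbitrary: t)
  case id
  show ?case
    by (rule bexI[OF _ id], rule bexI[OF _ endo_monoid.id]) simp
next
  case (incl \<delta>)
  then have "\<Delta> \<delta> t \<in> endo_monoid \<Phi>'"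
    by (auto simp: \<Phi>' intro: endo_monoid.incl)
  then show ?case
    using incl pull same by blast
next
  case (comp \<sigma> \<tau>)
  obtain s1 \<sigma>' where s1: "s1 \<in> S" "\<sigma>' \<in> endo_monoid \<Phi>'"
      "\<And>i w. i \<in> \<Omega> \<Longrightarrow> w \<in> carrier F \<Longrightarrow> \<sigma>' (\<rho> s1 i w) = \<rho> t i (\<sigma> w)"
    using comp.IH(1)[OF comp.prems] by blast
  obtain s \<tau>' where s: "s \<in> S" "\<tau>' \<in> endo_monoid \<Phi>'"
      "\<And>i w. i \<in> \<Omega> \<Longrightarrow> w \<in> carrier F \<Longrightarrow> \<tau>' (\<rho> s i w) = \<rho> s1 i (\<tau> w)"
    using comp.IH(2)[OF s1(1)] by blast
  have "\<tau> w \<in> carrier F" if "w \<in> carrier F" for w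
    using hom_in_carrier[OF endo_monoid_hom[OF \<Phi> comp.hyps(2)] that] .
  then have "(\<sigma>' \<circ> \<tau>') (\<rho> s i w) = \<rho> t i ((\<sigma> \<circ> \<tau>) w)" if "i \<in> \<Omega>" "w \<in> carrier F" for i w
    using s(3)[OF that] s1(3)[OF that(1), of "\<tau> w"] that by simp
  then show ?case
    using s(1) endo_monoid.comp[OF s1(2) s(2)] by blast
qed

text \<open>The converse control: each generator either lifts some \<delta> on a graph or collapses
  that graph to \<open>z\<close>, and both outcomes persist under composition. It ensures that the
  new iterated relators impose nothing beyond rewritten relators of \<open>G\<close>.\<close>

lemma endo_monoid_lift_cases:
  assumes \<Phi>': "\<Phi>' = (\<lambda>(\<delta>, t). \<Delta> \<delta> t) ` (\<Phi> \<times> S)"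
    and \<Phi>: "\<Phi> \<subseteq> hom F F"
    and one: "\<And>\<delta> t. \<delta> \<in> \<Phi> \<Longrightarrow> t \<in> S \<Longrightarrow> \<Delta> \<delta> t z = z"
    and same: "\<And>\<delta> t i w. \<delta> \<in> \<Phi> \<Longrightarrow> t \<in> S \<Longrightarrow> i \<in> \<Omega> \<Longrightarrow> w \<in> carrier F \<Longrightarrow>
                 \<Delta> \<delta> t (\<rho> (P \<delta> t) i w) = \<rho> t i (\<delta> w)"
    and other: "\<And>\<delta> t s i w. \<delta> \<in> \<Phi> \<Longrightarrow> t \<in> S \<Longrightarrow> s \<in> S \<Longrightarrow> s \<noteq> P \<delta> t \<Longrightarrow> i \<in> \<Omega> \<Longrightarrow> w \<in> carrier F \<Longrightarrow>
                 \<Delta> \<delta> t (\<rho> s i w) = z"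
    and "\<sigma>' \<in> endo_monoid \<Phi>'"
  shows "\<sigma>' z = z \<and> (\<forall>s\<in>S. \<forall>i\<in>\<Omega>. \<forall>w\<in>carrier F.
           \<sigma>' (\<rho> s i w) = z \<or> (\<exists>t\<in>S. \<exists>\<sigma>\<in>endo_monoid \<Phi>. \<sigma>' (\<rho> s i w) = \<rho> t i (\<sigma> w)))"
  using assms(6)
proof induction
  case id
  have "\<exists>t\<in>S. \<exists>\<sigma>\<in>endo_monoid \<Phi>. id (\<rho> s i w) = \<rho> t i (\<sigma> w)" if "s \<in> S" for s i w
    by (rule bexI[OF _ that], rule bexI[OF _ endo_monoid.id]) simp
  then show ?case
    by simp
next
  case (incl \<phi>)
  then obtain \<delta> t where \<phi>: "\<phi> = \<Delta> \<delta> t" "\<delta> \<in> \<Phi>" "t \<in> S"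
    by (auto simp: \<Phi>')
  have "\<phi> (\<rho> s i w) = z \<or> (\<exists>t\<in>S. \<exists>\<sigma>\<in>endo_monoid \<Phi>. \<phi> (\<rho> s i w) = \<rho> t i (\<sigma> w))"
    if "s \<in> S" "i \<in> \<Omega>" "w \<in> carrier F" for s i w
  proof (cases "s = P \<delta> t")
    case True
    then show ?thesis
      unfolding \<phi>(1) using same[OF \<phi>(2,3) that(2,3)] \<phi>(2,3) endo_monoid.incl by blast
  next
    case False
    then show ?thesis
      unfolding \<phi>(1) using other[OF \<phi>(2,3) that(1) _ that(2,3)] by blast
  qed
  then show ?case
    using one[OF \<phi>(2,3)] \<phi>(1) by simp
next
  case (comp \<sigma>' \<tau>')
  have "\<sigma>' (\<tau>' (\<rho> s i w)) = z \<or> (\<exists>t\<in>S. \<exists>\<sigma>\<in>endo_monoid \<Phi>. \<sigma>' (\<tau>' (\<rho> s i w)) = \<rho> t i (\<sigma> w))"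
    if siw: "s \<in> S" "i \<in> \<Omega>" "w \<in> carrier F" for s i w
  proof (cases "\<tau>' (\<rho> s i w) = z")
    case False
    then obtain t \<tau> where t: "t \<in> S" "\<tau> \<in> endo_monoid \<Phi>" "\<tau>' (\<rho> s i w) = \<rho> t i (\<tau> w)"
      using comp.IH(2) siw by blast
    have "\<tau> w \<in> carrier F"
      using hom_in_carrier[OF endo_monoid_hom[OF \<Phi> t(2)] siw(3)] .
    then have "\<sigma>' (\<rho> t i (\<tau> w)) = z \<or>
        (\<exists>u\<in>S. \<exists>\<sigma>\<in>endo_monoid \<Phi>. \<sigma>' (\<rho> t i (\<tau> w)) = \<rho> u i (\<sigma> (\<tau> w)))"
      using comp.IH(1) t(1) siw(2) by blast
    then show ?thesis
      unfolding t(3) using endo_monoid.comp[OF _ t(2)] by (metis comp_apply)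
  qed (use comp.IH(1) in simp)
  then show ?case
    using comp.IH by simp
qed

text \<open>The Reidemeister-Schreier method, with \<open>G\<close> given by an epimorphism from
  \<open>F\<close> so that \<open>F\<close> acts on the cosets of \<open>H\<close> through
  \<theta>.\<close>

lemma subgroup_finitely_L_presented:
  fixes G :: "('a, 'b) monoid_scheme" and X :: "'x set"
  defines "F \<equiv> free_group X"
  assumes "group G" and pres: "finite_L_presentation X Q \<Phi> R"
    and \<theta>: "\<theta> \<in> hom F G" "\<theta> ` carrier F = carrier G"
    and ker: "kernel F G \<theta> = normal_closure F (Q \<union> (\<Union>\<sigma>\<in>endo_monoid \<Phi>. \<sigma> ` R))"
    and H: "subgroup H G" and fin: "finite (rcosets\<^bsub>G\<^esub> H)"
  shows "finitely_L_presented (G\<lparr>carrier := H\<rparr>)"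
proof -
  interpret G: group G by fact
  interpret F: group F
    unfolding F_def by (rule group_free_group)
  interpret H: group "G\<lparr>carrier := H\<rparr>"
    using H G.subgroup_imp_group by blast
  have HG: "H \<subseteq> carrier G"
    using H by (simp add: subgroup.subset)
  interpret \<theta>: group_hom F G \<theta>
    by unfold_locales (rule \<theta>(1))
  have finX: "finite X" and finQ: "finite Q" and Q: "Q \<subseteq> carrier F" and fin\<Phi>: "finite \<Phi>"
    and \<Phi>: "\<Phi> \<subseteq> hom F F" and finR: "finite R" and R: "R \<subseteq> carrier F"
    using pres by (auto simp: finite_L_presentation_def F_def)
  have F_simps [simp]: "w \<in> carrier F \<longleftrightarrow> fst ` set w \<subseteq> X \<and> reduced w"
    "u \<otimes>\<^bsub>F\<^esub> v = reduce (u @ v)" "\<one>\<^bsub>F\<^esub> = []" for u v w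
    by (auto simp: F_def)
  have \<theta>_mult: "\<theta> (reduce (u @ v)) = \<theta> u \<otimes>\<^bsub>G\<^esub> \<theta> v" if "u \<in> carrier F" "v \<in> carrier F" for u v
    using \<theta>.hom_mult[OF that] by simp
  have \<theta>_Nil [simp]: "\<theta> [] = \<one>\<^bsub>G\<^esub>"
    using \<theta>.hom_one by simp

  \<comment> \<open>The action of \<open>F\<close> on the cosets of \<open>H\<close>\<close>
  define \<Omega> where "\<Omega> = rcosets\<^bsub>G\<^esub> H"
  define S where "S = letter_actions \<Omega> X"
  \<comment> \<open>The distinguished action: its Schreier graph is the coset graph of
    \<open>H\<close>. The other members of \<open>S\<close> serve to carry the iterated
    relators.\<close>
  define b where "b = letter_action \<Omega> X (\<lambda>C u. C #>\<^bsub>G\<^esub> \<theta> u)"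
  have \<Omega>_sub: "C \<subseteq> carrier G" if "C \<in> \<Omega>" for C
    using that G.rcosets_subset_PowG[OF H] by (auto simp: \<Omega>_def)
  have H\<Omega>: "H \<in> \<Omega>"
    using H unfolding \<Omega>_def by (rule subgroup.subgroup_in_rcosets) fact
  have \<Omega>_rep: "\<exists>g\<in>carrier G. C = H #>\<^bsub>G\<^esub> g" if "C \<in> \<Omega>" for C
    using that by (auto simp: \<Omega>_def RCOSETS_def)
  have \<Omega>_closed: "C #>\<^bsub>G\<^esub> g \<in> \<Omega>" if "C \<in> \<Omega>" "g \<in> carrier G" for C g
    using \<Omega>_rep[OF that(1)] that(2) HG by (auto simp: \<Omega>_def G.coset_mult_assoc intro!: G.rcosetsI)
  have act: "C #>\<^bsub>G\<^esub> \<theta> u \<in> \<Omega>" if "C \<in> \<Omega>" "u \<in> carrier F" for C u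
    using \<Omega>_closed[OF that(1) \<theta>.hom_closed[OF that(2)]] .
  have act_Nil: "C #>\<^bsub>G\<^esub> \<theta> [] = C" if "C \<in> \<Omega>" for C
    using G.coset_mult_one[OF \<Omega>_sub[OF that]] by simp
  have act_mult: "C #>\<^bsub>G\<^esub> \<theta> (reduce (u @ v)) = (C #>\<^bsub>G\<^esub> \<theta> u) #>\<^bsub>G\<^esub> \<theta> v"
    if "C \<in> \<Omega>" "u \<in> carrier F" "v \<in> carrier F" for C u v
    using G.coset_mult_assoc[OF \<Omega>_sub[OF that(1)]] \<theta>_mult[OF that(2,3)]
      \<theta>.hom_closed[OF that(2)] \<theta>.hom_closed[OF that(3)]
    by simp
  have bS: "b \<in> S"
    unfolding S_def b_def
    by (rule letter_action_in_letter_actions; (rule act act_Nil act_mult)?) (simp_all add: F_def)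
  have fold_b: "foldl b C w = C #>\<^bsub>G\<^esub> \<theta> w" if "C \<in> \<Omega>" "w \<in> carrier F" for C w
    unfolding b_def
    by (rule foldl_letter_action; (rule act act_Nil act_mult)?) (use that in \<open>simp_all add: F_def\<close>)
  have finS: "finite S" and fin\<Omega>: "finite \<Omega>"
    using finite_letter_actions[of \<Omega> X] fin finX by (auto simp: S_def \<Omega>_def)

  \<comment> \<open>The alphabet of edges and the rewriting maps\<close>
  define A where "A = S \<times> \<Omega> \<times> X"
  \<comment> \<open>The new alphabet has to consist of natural numbers, so edges are encoded by an
    enumeration of the finite set \<open>A\<close>, which \<open>d\<close> inverts.\<close>
  define e where "e = (\<lambda>s i x. to_nat_on A (s, i, x))"
  define d where "d = from_nat_into A"
  define Y where "Y = to_nat_on A ` A"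
  define E where "E = free_group Y"
  define \<rho> where "\<rho> = (\<lambda>s i w. reduce (edge_path (e s) s i w))"
  interpret E: group E
    unfolding E_def by (rule group_free_group)
  have E_simps [simp]: "w \<in> carrier E \<longleftrightarrow> fst ` set w \<subseteq> Y \<and> reduced w"
    "u \<otimes>\<^bsub>E\<^esub> v = reduce (u @ v)" "\<one>\<^bsub>E\<^esub> = []" for u v w
    by (auto simp: E_def)
  have finA: "finite A"
    using finS fin\<Omega> finX by (simp add: A_def)
  have d_e: "d (e s i x) = (s, i, x)" if "s \<in> S" "i \<in> \<Omega>" "x \<in> X" for s i x
    using that finA by (auto simp: d_def e_def A_def countable_finite)
  have eY: "e s i x \<in> Y" if "s \<in> S" "i \<in> \<Omega>" "x \<in> X" for s i x
    using that by (auto simp: e_def Y_def A_def)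
  have Y_cases: "\<exists>s\<in>S. \<exists>i\<in>\<Omega>. \<exists>x\<in>X. y = e s i x" if "y \<in> Y" for y
    using that by (auto simp: e_def Y_def A_def)
  have \<rho>_closed: "\<rho> s i w \<in> carrier E" if "s \<in> S" "i \<in> \<Omega>" "w \<in> carrier F" for s i w
  proof -
    have "fst ` set (edge_path (e s) s i w) \<subseteq> Y"
      using edge_path_letters[of s \<Omega> X i w "e s"] that eY by (force simp: S_def)
    then show ?thesis
      using fst_set_reduce_subset[of _ Y] by (simp add: \<rho>_def)
  qed
  have \<rho>_mult: "\<rho> s i (reduce (u @ v)) = \<rho> s i u \<otimes>\<^bsub>E\<^esub> \<rho> s (foldl s i u) v" if "s \<in> S" for s i u v
    using reduce_edge_path_mult[of s \<Omega> X "e s" i u v] that by (simp add: \<rho>_def S_def)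
  have \<rho>_letter: "\<rho> s i [(x, True)] = [(e s i x, True)]" for s i x
    by (simp add: \<rho>_def reduce_reduced)
  have \<rho>_Nil [simp]: "\<rho> s i [] = []" for s i
    by (simp add: \<rho>_def)

  \<comment> \<open>Lifts of the endomorphisms\<close>
  define \<Delta> where "\<Delta> = (\<lambda>\<delta> t. word_value E
    (\<lambda>y. case d y of (s, i, x) \<Rightarrow> if s = pullback \<Omega> X \<delta> t then \<rho> t i (\<delta> [(x, True)]) else []))"
  \<comment> \<open>There is one endomorphism for each pair: different \<open>t\<close> may have the
    same pullback along \<delta>, and then an edge needs a separate image in each of the target
    graphs.\<close>
  define \<Phi>' where "\<Phi>' = (\<lambda>(\<delta>, t). \<Delta> \<delta> t) ` (\<Phi> \<times> S)"
  have \<Phi>_closed: "\<delta> w \<in> carrier F" if "\<delta> \<in> \<Phi>" "w \<in> carrier F" for \<delta> w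
    using hom_in_carrier[OF subsetD[OF \<Phi> that(1)] that(2)] .
  have pull: "pullback \<Omega> X \<delta> t \<in> S" if "\<delta> \<in> \<Phi>" "t \<in> S" for \<delta> t
    using that(2) subsetD[OF \<Phi> that(1)] pullback_in_letter_actions[of t \<Omega> X \<delta>]
    by (simp add: S_def F_def)
  have \<Delta>_hom: "\<Delta> \<delta> t \<in> hom E E" if "\<delta> \<in> \<Phi>" "t \<in> S" for \<delta> t
    unfolding \<Delta>_def E_def
  proof (rule group.word_value_hom[OF group_free_group], fold E_def, rule Pi_I)
    fix y assume "y \<in> Y"
    then obtain s i x where y: "s \<in> S" "i \<in> \<Omega>" "x \<in> X" "y = e s i x"
      using Y_cases by blast
    then show "(case d y of (s, i, x) \<Rightarrow>
        if s = pullback \<Omega> X \<delta> t then \<rho> t i (\<delta> [(x, True)]) else []) \<in> carrier E"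
      using d_e[OF y(1-3)] \<rho>_closed[OF that(2) y(2) \<Phi>_closed[OF that(1), of "[(x, True)]"]] by simp
  qed
  have \<Delta>_same: "\<Delta> \<delta> t (\<rho> (pullback \<Omega> X \<delta> t) i w) = \<rho> t i (\<delta> w)"
    if \<delta>: "\<delta> \<in> \<Phi>" "t \<in> S" and iw: "i \<in> \<Omega>" "w \<in> carrier F" for \<delta> t i w
    unfolding \<Delta>_def \<rho>_def[THEN fun_cong, THEN fun_cong, THEN fun_cong, of "pullback \<Omega> X \<delta> t" i w]
  \<comment> \<open>Composed with \<delta>, rewriting in the graph of \<open>t\<close> is a cocycle
    for the pulled back action, and its values on single generators are the images that
    \<open>\<Delta> \<delta> t\<close> gives to the edges.\<close>
  proof (rule E.word_value_edge_path[where c = "\<lambda>i w. \<rho> t i (\<delta> w)"])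
    show "pullback \<Omega> X \<delta> t \<in> letter_actions \<Omega> X"
      using pull[OF \<delta>] by (simp add: S_def)
    show "\<rho> t j (\<delta> u) \<in> carrier E" if "j \<in> \<Omega>" "u \<in> carrier (free_group X)" for j u
      using \<rho>_closed[OF \<delta>(2) that(1) \<Phi>_closed[OF \<delta>(1)]] that(2) unfolding F_def .
    show "\<rho> t j (\<delta> (reduce (u @ v))) = \<rho> t j (\<delta> u) \<otimes>\<^bsub>E\<^esub> \<rho> t (foldl (pullback \<Omega> X \<delta> t) j u) (\<delta> v)"
      if "j \<in> \<Omega>" "u \<in> carrier (free_group X)" "v \<in> carrier (free_group X)" for j u v
    proof -
      have h: "\<delta> \<in> hom (free_group X) (free_group X)"
        using subsetD[OF \<Phi> \<delta>(1)] by (simp add: F_def)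
      then have "\<delta> (reduce (u @ v)) = reduce (\<delta> u @ \<delta> v)"
        using hom_free_group_reduce_append[OF h] that by simp
      then show ?thesis
        using \<rho>_mult[OF \<delta>(2)] foldl_pullback[of t \<Omega> X \<delta> j u] h \<delta>(2) that by (simp add: S_def)
    qed
  qed (use iw d_e pull[OF \<delta>] in \<open>auto simp: F_def\<close>)
  have \<Delta>_other: "\<Delta> \<delta> t (\<rho> s i w) = []"
    if \<delta>: "\<delta> \<in> \<Phi>" "t \<in> S" and s: "s \<in> S" "s \<noteq> pullback \<Omega> X \<delta> t"
      and iw: "i \<in> \<Omega>" "w \<in> carrier F" for \<delta> t s i w
    unfolding \<Delta>_def \<rho>_def[THEN fun_cong, THEN fun_cong, THEN fun_cong, of s i w]
    \<comment> \<open>All edges of the graph of \<open>s\<close> go to the empty word, so the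
      constant cocycle applies.\<close>
    by (rule E.word_value_edge_path[where c = "\<lambda>i w. []" and \<Omega> = \<Omega> and X = X])
      (use s iw d_e in \<open>auto simp: S_def\<close>)
  have \<Delta>_Nil: "\<Delta> \<delta> t [] = []" for \<delta> t
    unfolding \<Delta>_def by simp

  \<comment> \<open>Transversal and new relators\<close>
  have "\<forall>C\<in>\<Omega>. \<exists>w\<in>carrier F. H #>\<^bsub>G\<^esub> \<theta> w = C \<and> (C = H \<longrightarrow> w = [])"
  proof
    fix C assume C: "C \<in> \<Omega>"
    show "\<exists>w\<in>carrier F. H #>\<^bsub>G\<^esub> \<theta> w = C \<and> (C = H \<longrightarrow> w = [])"
    proof (cases "C = H")
      \<comment> \<open>The coset \<open>H\<close> gets the empty word as representative, so that
        later a loop at \<open>H\<close> with label \<open>w\<close> takes the value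
        \<open>\<theta> w\<close>.\<close>
      case True
      then show ?thesis
        using HG by (intro bexI[of _ "[]"]) auto
    next
      case False
      obtain g where g: "g \<in> carrier G" "C = H #>\<^bsub>G\<^esub> g"
        using \<Omega>_rep[OF C] by blast
      then obtain w where "w \<in> carrier F" "g = \<theta> w"
        using \<theta>(2) by (metis imageE)
      then show ?thesis
        using g False by blast
    qed
  qed
  then have "\<exists>T. \<forall>C\<in>\<Omega>. T C \<in> carrier F \<and> H #>\<^bsub>G\<^esub> \<theta> (T C) = C \<and> (C = H \<longrightarrow> T C = [])"
    by metis
  then obtain T
    where T: "\<forall>C\<in>\<Omega>. T C \<in> carrier F \<and> H #>\<^bsub>G\<^esub> \<theta> (T C) = C \<and> (C = H \<longrightarrow> T C = [])" ..
  have T: "\<And>C. C \<in> \<Omega> \<Longrightarrow> T C \<in> carrier F" "\<And>C. C \<in> \<Omega> \<Longrightarrow> H #>\<^bsub>G\<^esub> \<theta> (T C) = C" "T H = []"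
    using T[rule_format] H\<Omega> by (simp_all del: F_simps)
  have T_inv: "inv\<^bsub>F\<^esub> T C \<in> carrier F" if "C \<in> \<Omega>" for C
    using T(1)[OF that] by (rule F.inv_closed)
  \<comment> \<open>These relators belong to the part that is not iterated:
    \<open>\<Delta> \<delta> b\<close> may send an edge of another graph to a word in the graph of
    \<open>b\<close> that is not trivial in \<open>H\<close>.\<close>
  define Q1 where "Q1 = (\<lambda>(s, i, x). [(e s i x, True)]) ` ((S - {b}) \<times> \<Omega> \<times> X)"
  define Q2 where "Q2 = (\<lambda>i. \<rho> b H (T i)) ` \<Omega>"
  define Q3 where "Q3 = (\<lambda>(i, q). \<rho> b i q) ` (\<Omega> \<times> Q)"
  \<comment> \<open>All actions \<open>s\<close> occur, because a lift that ends in the graph of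
    \<open>b\<close> starts in the graph of some iterated pullback of \<open>b\<close>.\<close>
  define R' where "R' = (\<lambda>(s, i, r). \<rho> s i r) ` (S \<times> \<Omega> \<times> R)"
  have pres': "finite_L_presentation Y (Q1 \<union> Q2 \<union> Q3) \<Phi>' R'"
    unfolding finite_L_presentation_def E_def[symmetric]
  proof (intro conjI)
    show "finite Y" "finite (Q1 \<union> Q2 \<union> Q3)" "finite \<Phi>'" "finite R'"
      using finA finS fin\<Omega> finX finQ finR fin\<Phi>
      by (auto simp: Y_def Q1_def Q2_def Q3_def \<Phi>'_def R'_def)
    have "Q1 \<subseteq> carrier E"
      using eY by (auto simp: Q1_def)
    moreover have "Q2 \<subseteq> carrier E"
      unfolding Q2_def by (rule image_subsetI) (rule \<rho>_closed[OF bS H\<Omega> T(1)])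
    moreover have "Q3 \<subseteq> carrier E"
      unfolding Q3_def using \<rho>_closed[OF bS _ subsetD[OF Q]]
      by (intro image_subsetI) (auto simp del: E_simps)
    ultimately show "Q1 \<union> Q2 \<union> Q3 \<subseteq> carrier E"
      by blast
    show "R' \<subseteq> carrier E"
      unfolding R'_def using \<rho>_closed[OF _ _ subsetD[OF R]]
      by (intro image_subsetI) (auto simp del: E_simps)
    show "\<Phi>' \<subseteq> hom E E"
      using \<Delta>_hom by (auto simp: \<Phi>'_def)
  qed

  \<comment> \<open>The normal closure of the new relators and the kernel of \<theta>\<close>
  define Rels where "Rels = (Q1 \<union> Q2 \<union> Q3) \<union> (\<Union>\<sigma>\<in>endo_monoid \<Phi>'. \<sigma> ` R')"
  define N where "N = normal_closure E Rels"
  have sub': "Q1 \<union> Q2 \<union> Q3 \<subseteq> carrier E" "R' \<subseteq> carrier E" "\<Phi>' \<subseteq> hom E E"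
    using pres' unfolding finite_L_presentation_def E_def by simp_all
  have Rels: "Rels \<subseteq> carrier E"
    unfolding Rels_def using L_relators_closed[OF sub'] .
  have N: "N \<lhd> E"
    unfolding N_def using E.normal_normal_closure[OF Rels] .
  interpret N: normal N E by (rule N)
  have Rels_N: "Rels \<subseteq> N"
    unfolding N_def by (rule subset_normal_closure)
  have \<rho>_rel: "\<rho> b i (\<sigma> r) \<in> N" if "i \<in> \<Omega>" "\<sigma> \<in> endo_monoid \<Phi>" "r \<in> R" for i \<sigma> r
  proof -
    have "\<exists>s\<in>S. \<exists>\<sigma>'\<in>endo_monoid \<Phi>'. \<forall>j\<in>\<Omega>. \<forall>w\<in>carrier F. \<sigma>' (\<rho> s j w) = \<rho> b j (\<sigma> w)"
      by (rule endo_monoid_lift_exists[where \<Delta> = \<Delta> and P = "pullback \<Omega> X",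
            OF \<Phi>'_def \<Phi> pull \<Delta>_same that(2) bS])
    then obtain s \<sigma>' where s: "s \<in> S" "\<sigma>' \<in> endo_monoid \<Phi>'"
      and eq: "\<forall>j\<in>\<Omega>. \<forall>w\<in>carrier F. \<sigma>' (\<rho> s j w) = \<rho> b j (\<sigma> w)"
      by (elim bexE)
    have "r \<in> carrier F"
      using R that(3) by (rule subsetD)
    then have eq: "\<rho> b i (\<sigma> r) = \<sigma>' (\<rho> s i r)"
      using bspec[OF bspec[OF eq that(1)]] by simp
    have "\<rho> s i r \<in> R'"
      unfolding R'_def using s(1) that by (intro image_eqI[of _ _ "(s, i, r)"]) auto
    then have "\<rho> b i (\<sigma> r) \<in> Rels"
      unfolding Rels_def eq using s(2) by blast
    then show ?thesis
      using Rels_N by blast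
  qed

  text \<open>A normal subgroup that contains the relators of \<open>G\<close>, hence the kernel of \<open>\<theta>\<close>.\<close>
  define M where "M = {w \<in> carrier F. \<forall>i\<in>\<Omega>. foldl b i w = i \<and> \<rho> b i w \<in> N}"
  have bL: "b \<in> letter_actions \<Omega> X"
    using bS by (simp add: S_def)
  have b_closed: "foldl b i w \<in> \<Omega>" if "i \<in> \<Omega>" for i w
    using foldl_action_closed[OF bL that] .
  have fold_reduce: "foldl b i (reduce w) = foldl b i w" for i w
    using foldl_action_reduce[OF bL] .
  have fold_inv: "foldl b (foldl b i w) (inv\<^bsub>F\<^esub> w) = i" if "i \<in> \<Omega>" "w \<in> carrier F" for i w
  proof -
    have "reduce (w @ inv\<^bsub>F\<^esub> w) = []"
      using F.r_inv[OF that(2)] by simp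
    then show ?thesis
      by (metis fold_reduce foldl_append foldl_Nil)
  qed
  have \<rho>_inv: "\<rho> b (foldl b i w) (inv\<^bsub>F\<^esub> w) = inv\<^bsub>E\<^esub> (\<rho> b i w)" if "i \<in> \<Omega>" "w \<in> carrier F" for i w
  proof -
    have "\<rho> b i w \<otimes>\<^bsub>E\<^esub> \<rho> b (foldl b i w) (inv\<^bsub>F\<^esub> w) = \<one>\<^bsub>E\<^esub>"
      using \<rho>_mult[OF bS, of i w "inv\<^bsub>F\<^esub> w"] F.r_inv[OF that(2)] by simp
    then show ?thesis
      using \<rho>_closed[OF bS that] \<rho>_closed[OF bS b_closed[OF that(1)] F.inv_closed[OF that(2)]]
      by (metis E.inv_equality E.inv_inv E.inv_closed)
  qed
  have M_mult: "u \<otimes>\<^bsub>F\<^esub> v \<in> M" if "u \<in> M" "v \<in> M" for u v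
  proof -
    have uv: "u \<in> carrier F" "v \<in> carrier F"
      using that by (auto simp: M_def)
    then show ?thesis
      using that F.m_closed[OF uv] \<rho>_mult[OF bS] N.m_closed by (auto simp: M_def fold_reduce)
  qed
  have M_inv: "inv\<^bsub>F\<^esub> w \<in> M" if "w \<in> M" for w
  proof -
    have w: "w \<in> carrier F" "\<And>i. i \<in> \<Omega> \<Longrightarrow> foldl b i w = i" "\<And>i. i \<in> \<Omega> \<Longrightarrow> \<rho> b i w \<in> N"
      using that by (auto simp: M_def)
    then show ?thesis
      using F.inv_closed[OF w(1)] fold_inv[OF _ w(1)] \<rho>_inv[OF _ w(1)] N.m_inv_closed
      unfolding M_def by auto
  qed
  have M_conj: "g \<otimes>\<^bsub>F\<^esub> w \<otimes>\<^bsub>F\<^esub> inv\<^bsub>F\<^esub> g \<in> M" if "g \<in> carrier F" "w \<in> M" for g w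
  proof -
    have w: "w \<in> carrier F" "\<And>i. i \<in> \<Omega> \<Longrightarrow> foldl b i w = i" "\<And>i. i \<in> \<Omega> \<Longrightarrow> \<rho> b i w \<in> N"
      using that by (auto simp: M_def)
    have "foldl b i (g \<otimes>\<^bsub>F\<^esub> w \<otimes>\<^bsub>F\<^esub> inv\<^bsub>F\<^esub> g) = i" if "i \<in> \<Omega>" for i
      using w(2)[OF b_closed[OF that]] fold_inv[OF that \<open>g \<in> carrier F\<close>]
      by (simp add: fold_reduce)
    moreover have "\<rho> b i (g \<otimes>\<^bsub>F\<^esub> w \<otimes>\<^bsub>F\<^esub> inv\<^bsub>F\<^esub> g) \<in> N" if "i \<in> \<Omega>" for i
    proof -
      \<comment> \<open>Conjugation by \<open>g\<close> moves the starting point from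
        \<open>i\<close> to \<open>foldl b i g\<close>; since \<open>M\<close> imposes its condition
        at every point, the middle factor is still in \<open>N\<close>.\<close>
      have "\<rho> b i (g \<otimes>\<^bsub>F\<^esub> w \<otimes>\<^bsub>F\<^esub> inv\<^bsub>F\<^esub> g)
          = \<rho> b i g \<otimes>\<^bsub>E\<^esub> \<rho> b (foldl b i g) w \<otimes>\<^bsub>E\<^esub> inv\<^bsub>E\<^esub> (\<rho> b i g)"
        using \<rho>_mult[OF bS] w(2)[OF b_closed[OF that]] \<rho>_inv[OF that \<open>g \<in> carrier F\<close>]
        by (simp add: fold_reduce)
      then show ?thesis
        using N.inv_op_closed2 \<rho>_closed[OF bS that \<open>g \<in> carrier F\<close>] w(3)[OF b_closed[OF that]]
        by metis
    qed
    ultimately show ?thesis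
      using F.m_closed F.inv_closed that(1) w(1) unfolding M_def by blast
  qed
  have "subgroup M F"
    by (rule F.subgroupI) (use M_mult M_inv N.one_closed in \<open>auto simp: M_def intro!: exI[of _ "[]"]\<close>)
  then have M_normal: "M \<lhd> F"
    using M_conj by (simp add: F.normal_inv_iff)
  have ker_sub: "kernel F G \<theta> \<subseteq> M"
    unfolding ker
  proof (rule normal_closure_subset[OF M_normal], rule subsetI)
    fix w assume w: "w \<in> Q \<union> (\<Union>\<sigma>\<in>endo_monoid \<Phi>. \<sigma> ` R)"
    have wF: "w \<in> carrier F"
      using w L_relators_closed[OF Q R \<Phi>] by blast
    have "w \<in> kernel F G \<theta>"
      using w subset_normal_closure unfolding ker by fast
    then have "foldl b i w = i" if "i \<in> \<Omega>" for i
      using fold_b[OF that wF] \<Omega>_sub[OF that] by (simp add: kernel_def)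
    moreover have "\<rho> b i w \<in> N" if "i \<in> \<Omega>" for i
    proof (cases "w \<in> Q")
      case True
      then show ?thesis
        using that Rels_N unfolding Rels_def Q3_def by fast
    next
      case False
      then show ?thesis
        using w that \<rho>_rel by blast
    qed
    ultimately show "w \<in> M"
      using wF by (simp add: M_def)
  qed

  \<comment> \<open>The epimorphism onto \<open>H\<close>\<close>
  define c where "c = (\<lambda>i w. \<theta> (T i) \<otimes>\<^bsub>G\<^esub> \<theta> w \<otimes>\<^bsub>G\<^esub> inv\<^bsub>G\<^esub> \<theta> (T (foldl b i w)))"
  \<comment> \<open>Edges outside the graph of \<open>b\<close> get the value of the trivial
    cocycle, in accordance with the relators in \<open>Q1\<close>.\<close>
  define \<Psi> where "\<Psi> = word_value (G\<lparr>carrier := H\<rparr>)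
    (\<lambda>y. case d y of (s, i, x) \<Rightarrow> if s = b then c i [(x, True)] else \<one>\<^bsub>G\<^esub>)"
  have \<theta>T: "\<theta> (T i) \<in> carrier G" if "i \<in> \<Omega>" for i
    using T(1)[OF that] by (rule \<theta>.hom_closed)
  \<comment> \<open>The transversal words at both ends complete the path of \<open>w\<close> from
    \<open>i\<close> to a loop at \<open>H\<close>, and the label of such a loop has its value in
    \<open>H\<close>.\<close>
  have c_H: "c i w \<in> H" if "i \<in> \<Omega>" "w \<in> carrier F" for i w
  proof -
    have g: "\<theta> w \<in> carrier G" "\<theta> (T i) \<in> carrier G" "\<theta> (T (foldl b i w)) \<in> carrier G"
      using \<theta>T \<theta>.hom_closed[OF that(2)] b_closed that(1) by auto
    have "H #>\<^bsub>G\<^esub> (\<theta> (T i) \<otimes>\<^bsub>G\<^esub> \<theta> w) = H #>\<^bsub>G\<^esub> \<theta> (T (foldl b i w))"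
      using T(2)[OF that(1)] T(2)[OF b_closed[OF that(1)], of w] fold_b[OF that] g HG
      by (metis G.coset_mult_assoc)
    then have "H #>\<^bsub>G\<^esub> c i w = H"
      unfolding c_def using g HG by (simp add: G.coset_mult_inv2)
    then show ?thesis
      using G.coset_join1[OF _ _ H] g by (simp add: c_def)
  qed
  have c_mult: "c i (reduce (u @ v)) = c i u \<otimes>\<^bsub>G\<^esub> c (foldl b i u) v"
    if "i \<in> \<Omega>" "u \<in> carrier F" "v \<in> carrier F" for i u v
  proof -
    have g: "\<theta> u \<in> carrier G" "\<theta> v \<in> carrier G" "\<theta> (T i) \<in> carrier G"
      "\<theta> (T (foldl b i u)) \<in> carrier G" "\<theta> (T (foldl b (foldl b i u) v)) \<in> carrier G"
      using \<theta>T \<theta>.hom_closed that b_closed by auto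
    \<comment> \<open>The transversal factors at the common point of the two paths cancel.\<close>
    then have "inv\<^bsub>G\<^esub> \<theta> (T (foldl b i u)) \<otimes>\<^bsub>G\<^esub> (\<theta> (T (foldl b i u)) \<otimes>\<^bsub>G\<^esub> z) = z"
      if "z \<in> carrier G" for z
      using that by (simp add: G.m_assoc[symmetric])
    then show ?thesis
      using g \<theta>_mult[OF that(2,3)] by (simp add: c_def fold_reduce G.m_assoc)
  qed
  have \<Psi>_fun: "(\<lambda>y. case d y of (s, i, x) \<Rightarrow> if s = b then c i [(x, True)] else \<one>\<^bsub>G\<^esub>)
      \<in> Y \<rightarrow> carrier (G\<lparr>carrier := H\<rparr>)"
  proof (rule Pi_I)
    fix y assume "y \<in> Y"
    then obtain s i x where y: "s \<in> S" "i \<in> \<Omega>" "x \<in> X" "y = e s i x"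
      using Y_cases by blast
    then show "(case d y of (s, i, x) \<Rightarrow> if s = b then c i [(x, True)] else \<one>\<^bsub>G\<^esub>)
        \<in> carrier (G\<lparr>carrier := H\<rparr>)"
      using d_e[OF y(1-3)] c_H[OF y(2), of "[(x, True)]"] subgroup.one_closed[OF H] by simp
  qed
  then have \<Psi>_hom: "\<Psi> \<in> hom E (G\<lparr>carrier := H\<rparr>)"
    unfolding \<Psi>_def E_def by (rule H.word_value_hom)
  interpret \<Psi>: group_hom E "G\<lparr>carrier := H\<rparr>" \<Psi>
    by unfold_locales (rule \<Psi>_hom)
  have \<Psi>_b: "\<Psi> (\<rho> b i w) = c i w" if "i \<in> \<Omega>" "w \<in> carrier F" for i w
    unfolding \<Psi>_def \<rho>_def
    by (rule H.word_value_edge_path[where c = c and \<Omega> = \<Omega> and X = X])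
      (use bL bS that c_H c_mult d_e in \<open>auto simp: F_def\<close>)
  have \<Psi>_other: "\<Psi> (\<rho> s i w) = \<one>\<^bsub>G\<^esub>" if "s \<in> S" "s \<noteq> b" "i \<in> \<Omega>" "w \<in> carrier F" for s i w
    unfolding \<Psi>_def \<rho>_def
    by (rule H.word_value_edge_path[where c = "\<lambda>i w. \<one>\<^bsub>G\<^esub>" and \<Omega> = \<Omega> and X = X])
      (use that d_e subgroup.one_closed[OF H] in \<open>auto simp: S_def\<close>)
  have c_one: "c H w = \<theta> w" if "w \<in> carrier F" "foldl b H w = H" for w
    using that T(3) \<theta>.hom_closed[OF that(1)] by (simp add: c_def)
  have c_ker: "c i w = \<one>\<^bsub>G\<^esub>" if "i \<in> \<Omega>" "w \<in> kernel F G \<theta>" for i w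
  proof -
    have w: "w \<in> carrier F" "\<theta> w = \<one>\<^bsub>G\<^esub>"
      using that(2) by (auto simp: kernel_def)
    then have "foldl b i w = i"
      using fold_b[OF that(1) w(1)] \<Omega>_sub[OF that(1)] by simp
    then show ?thesis
      using w \<theta>T[OF that(1)] by (simp add: c_def)
  qed
  have \<Psi>_rel: "\<Psi> v = \<one>\<^bsub>G\<^esub>" if v: "v \<in> Rels" for v
  proof -
    consider (Q1) s i x where "s \<in> S" "s \<noteq> b" "i \<in> \<Omega>" "x \<in> X" "v = \<rho> s i [(x, True)]"
      | (Q2) i where "i \<in> \<Omega>" "v = \<rho> b H (T i)"
      | (Q3) i q where "i \<in> \<Omega>" "q \<in> Q" "v = \<rho> b i q"
      | (R) \<sigma>' s i r where "\<sigma>' \<in> endo_monoid \<Phi>'" "s \<in> S" "i \<in> \<Omega>" "r \<in> R" "v = \<sigma>' (\<rho> s i r)"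
      using v unfolding Rels_def Q1_def Q2_def Q3_def R'_def by (auto simp: \<rho>_letter)
    then show ?thesis
    proof cases
      case Q1
      then show ?thesis
        using \<Psi>_other[of s i "[(x, True)]"] by simp
    next
      case Q2
      \<comment> \<open>The path ends at \<open>i\<close> and \<open>T H\<close> is empty, so
        \<open>c H (T i)\<close> is \<open>\<theta> (T i)\<close> times its own inverse.\<close>
      have "foldl b H (T i) = i"
        using fold_b[OF H\<Omega> T(1)] T(2) Q2 by simp
      then show ?thesis
        using \<Psi>_b[OF H\<Omega> T(1)] T(3) Q2 \<theta>T[OF Q2(1)] by (simp add: c_def)
    next
      case Q3
      then have "q \<in> kernel F G \<theta>"
        using subset_normal_closure unfolding ker by fast
      then show ?thesis
        using Q3 Q \<Psi>_b[OF Q3(1), of q] c_ker[OF Q3(1)] by auto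
    next
      case R
      have rF: "r \<in> carrier F"
        using R(4) \<open>R \<subseteq> carrier F\<close> by blast
      \<comment> \<open>An iterated relator is empty or the rewriting of some
        \<open>\<sigma> r\<close>, and \<open>\<sigma> r\<close> lies in the kernel of
        \<theta>.\<close>
      have "\<sigma>' [] = [] \<and> (\<forall>s\<in>S. \<forall>i\<in>\<Omega>. \<forall>w\<in>carrier F.
          \<sigma>' (\<rho> s i w) = [] \<or> (\<exists>t\<in>S. \<exists>\<sigma>\<in>endo_monoid \<Phi>. \<sigma>' (\<rho> s i w) = \<rho> t i (\<sigma> w)))"
        by (rule endo_monoid_lift_cases[where \<Delta> = \<Delta> and P = "pullback \<Omega> X",
              OF \<Phi>'_def \<Phi> \<Delta>_Nil \<Delta>_same \<Delta>_other R(1)])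
      then have "v = [] \<or> (\<exists>t\<in>S. \<exists>\<sigma>\<in>endo_monoid \<Phi>. v = \<rho> t i (\<sigma> r))"
        using R(2,3,5) rF by blast
      then show ?thesis
      proof
        assume "v = []"
        then show ?thesis
          using \<Psi>.hom_one by simp
      next
        assume "\<exists>t\<in>S. \<exists>\<sigma>\<in>endo_monoid \<Phi>. v = \<rho> t i (\<sigma> r)"
        then obtain t \<sigma> where t: "t \<in> S" "\<sigma> \<in> endo_monoid \<Phi>" "v = \<rho> t i (\<sigma> r)"
          by blast
        have k: "\<sigma> r \<in> kernel F G \<theta>"
          using subset_normal_closure t(2) R(4) unfolding ker by fast
        then have "\<sigma> r \<in> carrier F"
          by (simp add: kernel_def)
        then show ?thesis
          using t \<Psi>_other[OF t(1) _ R(3)] \<Psi>_b[OF R(3)] c_ker[OF R(3) k] by (cases "t = b") auto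
      qed
    qed
  qed
  have N_ker: "N \<subseteq> kernel E (G\<lparr>carrier := H\<rparr>) \<Psi>"
    unfolding N_def
  proof (rule normal_closure_subset[OF \<Psi>.normal_kernel], rule subsetI)
    fix v assume "v \<in> Rels"
    then show "v \<in> kernel E (G\<lparr>carrier := H\<rparr>) \<Psi>"
      using subsetD[OF Rels] \<Psi>_rel by (simp add: kernel_def)
  qed
  have \<Psi>_surj: "\<Psi> ` carrier E = carrier (G\<lparr>carrier := H\<rparr>)"
  proof
    show "\<Psi> ` carrier E \<subseteq> carrier (G\<lparr>carrier := H\<rparr>)"
      using \<Psi>.hom_closed by blast
    show "carrier (G\<lparr>carrier := H\<rparr>) \<subseteq> \<Psi> ` carrier E"
    proof
      fix h assume "h \<in> carrier (G\<lparr>carrier := H\<rparr>)"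
      then have h: "h \<in> H" "h \<in> carrier G"
        using HG by auto
      then obtain w where w: "w \<in> carrier F" "\<theta> w = h"
        using \<theta>(2) by (metis imageE)
      \<comment> \<open>The coset \<open>H\<close> is fixed because \<open>\<theta> w\<close> lies
        in \<open>H\<close>; the loop with label \<open>w\<close> is thus a preimage of
        \<open>h\<close>.\<close>
      have "foldl b H w = H"
        using fold_b[OF H\<Omega> w(1)] w(2) h G.coset_join2[OF h(2) H h(1)] by simp
      then have "\<Psi> (\<rho> b H w) = h"
        using \<Psi>_b[OF H\<Omega> w(1)] c_one[OF w(1)] w(2) by simp
      then show "h \<in> \<Psi> ` carrier E"
        using \<rho>_closed[OF bS H\<Omega> w(1)] by blast
    qed
  qed

  \<comment> \<open>The kernel of \<Psi>\<close>
  interpret EN: group "E Mod N"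
    by (rule N.factorgroup_is_group)
  interpret q: group_hom E "E Mod N" "\<lambda>v. N #>\<^bsub>E\<^esub> v"
    by unfold_locales (rule N.r_coset_hom_Mod)
  have qN: "N #>\<^bsub>E\<^esub> v = \<one>\<^bsub>E Mod N\<^esub> \<longleftrightarrow> v \<in> N" if "v \<in> carrier E" for v
    using E.coset_join1[OF _ that] E.coset_join2[OF that] N.subgroup_axioms by auto
  text \<open>The paths along the transversal are killed, so an edge may be completed to a loop at \<open>H\<close>.\<close>
  have loop_letter: "\<exists>w\<in>carrier F. foldl b H w = H \<and> N #>\<^bsub>E\<^esub> [(y, True)] = N #>\<^bsub>E\<^esub> \<rho> b H w"
    if yY: "y \<in> Y" for y
  proof -
    obtain s i x where y: "s \<in> S" "i \<in> \<Omega>" "x \<in> X" "y = e s i x"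
      using Y_cases[OF yY] by blast
    show ?thesis
    proof (cases "s = b")
      case False
      then have "[(y, True)] \<in> Q1"
        unfolding Q1_def using y by (intro image_eqI[of _ _ "(s, i, x)"]) auto
      then have "[(y, True)] \<in> N"
        using Rels_N unfolding Rels_def by blast
      then have "N #>\<^bsub>E\<^esub> [(y, True)] = N #>\<^bsub>E\<^esub> \<rho> b H []"
        using qN[of "[(y, True)]"] qN[of "[]"] N.one_closed yY by simp
      then show ?thesis
        by (intro bexI[of _ "[]"]) auto
    next
      case True
      have yE: "[(y, True)] \<in> carrier E"
        using yY by simp
      define j where "j = foldl b i [(x, True)]"
      have x: "[(x, True)] \<in> carrier F"
        using y by simp
      have j: "j \<in> \<Omega>"
        unfolding j_def by (rule b_closed[OF y(2)])
      have end_T: "foldl b H (T k) = k" if "k \<in> \<Omega>" for k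
        using fold_b[OF H\<Omega> T(1)] T(2) that by simp
      have T_N: "N #>\<^bsub>E\<^esub> \<rho> b H (T k) = \<one>\<^bsub>E Mod N\<^esub>" if "k \<in> \<Omega>" for k
      proof -
        have "\<rho> b H (T k) \<in> Rels"
          using that unfolding Rels_def Q2_def by blast
        then show ?thesis
          using qN[OF \<rho>_closed[OF bS H\<Omega> T(1)[OF that]]] Rels_N by blast
      qed
      define w where "w = T i \<otimes>\<^bsub>F\<^esub> [(x, True)] \<otimes>\<^bsub>F\<^esub> inv\<^bsub>F\<^esub> T j"
      have "w \<in> carrier F"
        unfolding w_def using T(1)[OF y(2)] x T_inv[OF j] by (intro F.m_closed)
      moreover have "foldl b H w = H"
        using end_T[OF y(2)] end_T[OF j] fold_inv[OF H\<Omega> T(1)[OF j]] j_def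
        by (simp add: w_def fold_reduce)
      moreover have "\<rho> b H w = \<rho> b H (T i) \<otimes>\<^bsub>E\<^esub> [(y, True)] \<otimes>\<^bsub>E\<^esub> inv\<^bsub>E\<^esub> (\<rho> b H (T j))"
        using \<rho>_mult[OF bS] end_T[OF y(2)] end_T[OF j] \<rho>_inv[OF H\<Omega> T(1)[OF j]] j_def y(4) True
        by (simp add: w_def fold_reduce \<rho>_letter)
      then have "N #>\<^bsub>E\<^esub> \<rho> b H w = N #>\<^bsub>E\<^esub> [(y, True)]"
        using T_N[OF y(2)] T_N[OF j]
          \<rho>_closed[OF bS H\<Omega> T(1)[OF y(2)]] \<rho>_closed[OF bS H\<Omega> T(1)[OF j]]
        by (simp del: E_simps one_FactGroup mult_FactGroup add: yE)
      ultimately show ?thesis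
        by metis
    qed
  qed
  \<comment> \<open>Loops at \<open>H\<close> are closed under products and inverses, so the
    representation of letters by loops extends to all words.\<close>
  have loop: "\<exists>w\<in>carrier F. foldl b H w = H \<and> N #>\<^bsub>E\<^esub> v = N #>\<^bsub>E\<^esub> \<rho> b H w" if "v \<in> carrier E" for v
    using that
  proof (induction v)
    case Nil
    show ?case
      by (intro bexI[of _ "[]"]) auto
  next
    case (Cons a v)
    have v: "v \<in> carrier E" and a: "fst a \<in> Y" and av: "a # v = [a] \<otimes>\<^bsub>E\<^esub> v"
      using Cons.prems reduced_tl[of a v] reduce_reduced[of "a # v"] by auto
    have aE: "[a] \<in> carrier E" "[letter_inv a] \<in> carrier E"
      using a by auto
    obtain w where w: "w \<in> carrier F" "foldl b H w = H" "N #>\<^bsub>E\<^esub> v = N #>\<^bsub>E\<^esub> \<rho> b H w"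
      using Cons.IH[OF v] by blast
    obtain u where u: "u \<in> carrier F" "foldl b H u = H"
      "N #>\<^bsub>E\<^esub> [(fst a, True)] = N #>\<^bsub>E\<^esub> \<rho> b H u"
      using loop_letter[OF a] by blast
    obtain u' where u': "u' \<in> carrier F" "foldl b H u' = H" "N #>\<^bsub>E\<^esub> [a] = N #>\<^bsub>E\<^esub> \<rho> b H u'"
    proof (cases "snd a")
      case True
      then show ?thesis
        using u that[of u] by (cases a) simp
    next
      case False
      then have "[letter_inv a] = [(fst a, True)]"
        by (simp add: letter_inv_def)
      moreover have "[a] = inv\<^bsub>E\<^esub> [letter_inv a]"
        using E.inv_equality[of "[a]" "[letter_inv a]"] aE by (simp add: reduce_def)
      ultimately have "N #>\<^bsub>E\<^esub> [a] = N #>\<^bsub>E\<^esub> inv\<^bsub>E\<^esub> \<rho> b H u"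
        using q.hom_inv aE u(3) \<rho>_closed[OF bS H\<Omega> u(1)] by metis
      moreover have "\<rho> b H (inv\<^bsub>F\<^esub> u) = inv\<^bsub>E\<^esub> \<rho> b H u" "foldl b H (inv\<^bsub>F\<^esub> u) = H"
        using \<rho>_inv[OF H\<Omega> u(1)] fold_inv[OF H\<Omega> u(1)] u(2) by auto
      ultimately show ?thesis
        using that[of "inv\<^bsub>F\<^esub> u"] F.inv_closed[OF u(1)] by simp
    qed
    have "N #>\<^bsub>E\<^esub> (a # v) = N #>\<^bsub>E\<^esub> (\<rho> b H u' \<otimes>\<^bsub>E\<^esub> \<rho> b H w)"
      unfolding av
      using q.hom_mult[OF aE(1) v] q.hom_mult[OF \<rho>_closed[OF bS H\<Omega> u'(1)] \<rho>_closed[OF bS H\<Omega> w(1)]]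
        u'(3) w(3) by metis
    also have "\<rho> b H u' \<otimes>\<^bsub>E\<^esub> \<rho> b H w = \<rho> b H (u' \<otimes>\<^bsub>F\<^esub> w)"
      using \<rho>_mult[OF bS, of H u' w] u'(2) by simp
    finally show ?case
      using F.m_closed[OF u'(1) w(1)] u'(2) w(2)
      by (intro bexI[of _ "u' \<otimes>\<^bsub>F\<^esub> w"]) (auto simp: fold_reduce)
  qed
  have ker_N: "kernel E (G\<lparr>carrier := H\<rparr>) \<Psi> \<subseteq> N"
  proof
    fix v assume "v \<in> kernel E (G\<lparr>carrier := H\<rparr>) \<Psi>"
    then have v: "v \<in> carrier E" "\<Psi> v = \<one>\<^bsub>G\<^esub>"
      by (auto simp: kernel_def)
    \<comment> \<open>Modulo \<open>N\<close> it suffices to treat a loop at \<open>H\<close>. Its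
      value under \<Psi> is \<open>\<theta> w\<close>, so a trivial value puts \<open>w\<close> into
      the kernel of \<theta>, hence into \<open>M\<close>, and the loop into
      \<open>N\<close>.\<close>
    obtain w where w: "w \<in> carrier F" "foldl b H w = H" "N #>\<^bsub>E\<^esub> v = N #>\<^bsub>E\<^esub> \<rho> b H w"
      using loop[OF v(1)] by blast
    have \<rho>w: "\<rho> b H w \<in> carrier E"
      using \<rho>_closed[OF bS H\<Omega> w(1)] .
    have "\<rho> b H w \<in> N #>\<^bsub>E\<^esub> v"
      using E.rcos_self[OF \<rho>w N.subgroup_axioms] w(3) by simp
    then obtain n where n: "n \<in> N" "\<rho> b H w = n \<otimes>\<^bsub>E\<^esub> v"
      by (auto simp: r_coset_def)
    have "n \<in> carrier E" "\<Psi> n = \<one>\<^bsub>G\<^esub>"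
      using n(1) N_ker by (auto simp: kernel_def)
    then have "\<Psi> (\<rho> b H w) = \<one>\<^bsub>G\<^esub>"
      unfolding n(2) using \<Psi>.hom_mult[of n v] v by simp
    then have "w \<in> kernel F G \<theta>"
      using \<Psi>_b[OF H\<Omega> w(1)] c_one[OF w(1,2)] w(1) by (simp add: kernel_def)
    then have "\<rho> b H w \<in> N"
      using ker_sub H\<Omega> by (auto simp: M_def)
    then show "v \<in> N"
      using qN[OF \<rho>w] qN[OF v(1)] w(3) by simp
  qed

  \<comment> \<open>The isomorphism of \<open>H\<close> with the presented group\<close>
  have "E Mod N \<cong> G\<lparr>carrier := H\<rparr>"
    using \<Psi>.FactGroup_iso[OF \<Psi>_surj] N_ker ker_N by (metis subset_antisym)
  then have "G\<lparr>carrier := H\<rparr> \<cong> L_presented_group Y (Q1 \<union> Q2 \<union> Q3) \<Phi>' R'"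
    unfolding L_presented_group_def E_def[symmetric] Rels_def[symmetric] N_def[symmetric]
    using N.factorgroup_is_group group.iso_sym by blast
  then show ?thesis
    using pres' unfolding finitely_L_presented_def by blast
qed

theorem theorem1p1:
  fixes G :: "('a, 'b) monoid_scheme" and H :: "'a set"
  assumes "group G"
    and "finitely_L_presented G"
    and "subgroup H G"
    and "finite (rcosets\<^bsub>G\<^esub> H)"
  shows "finitely_L_presented (G\<lparr>carrier := H\<rparr>)"
proof -
  interpret G: group G by fact
  obtain X :: "nat set" and Q \<Phi> R where pres: "finite_L_presentation X Q \<Phi> R"
    and iso: "G \<cong> L_presented_group X Q \<Phi> R"
    using assms(2) unfolding finitely_L_presented_def by blast
  define F where "F = free_group X"
  define K where "K = normal_closure F (Q \<union> (\<Union>\<sigma>\<in>endo_monoid \<Phi>. \<sigma> ` R))"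
  interpret F: group F
    unfolding F_def by (rule group_free_group)
  have sub: "Q \<subseteq> carrier F" "R \<subseteq> carrier F" "\<Phi> \<subseteq> hom F F"
    using pres unfolding finite_L_presentation_def F_def by simp_all
  have "K \<lhd> F"
    unfolding K_def using L_relators_closed[OF sub] by (rule F.normal_normal_closure)
  then interpret K: normal K F .
  have "F Mod K \<cong> G"
    using G.iso_sym[OF iso] by (simp add: L_presented_group_def F_def K_def)
  then obtain h where h: "h \<in> iso (F Mod K) G"
    by (auto simp: is_iso_def)
  then have h_hom: "h \<in> hom (F Mod K) G" and h_bij: "bij_betw h (carrier (F Mod K)) (carrier G)"
    by (auto simp: iso_def)
  \<comment> \<open>The quotient map followed by the isomorphism gives an epimorphism from the free
    group whose kernel is the normal closure of the relators.\<close>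
  define \<theta> where "\<theta> = h \<circ> (\<lambda>w. K #>\<^bsub>F\<^esub> w)"
  have \<theta>: "\<theta> \<in> hom F G"
    unfolding \<theta>_def by (rule hom_compose[OF K.r_coset_hom_Mod h_hom])
  have "\<theta> ` carrier F = carrier G"
    using bij_betw_imp_surj_on[OF h_bij] unfolding \<theta>_def image_comp[symmetric] carrier_FactGroup .
  moreover have "kernel F G \<theta> = K"
  proof -
    have "\<theta> w = \<one>\<^bsub>G\<^esub> \<longleftrightarrow> w \<in> K" if w: "w \<in> carrier F" for w
    proof -
      have "h K = \<one>\<^bsub>G\<^esub>"
        using hom_one[OF h_hom K.factorgroup_is_group] by simp
      moreover have "K #>\<^bsub>F\<^esub> w \<in> carrier (F Mod K)" "K \<in> carrier (F Mod K)"
        using w K.subgroup_in_rcosets[OF F.group_axioms] F.rcosetsI[OF K.subset]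
        by (auto simp: FactGroup_def)
      ultimately have "\<theta> w = \<one>\<^bsub>G\<^esub> \<longleftrightarrow> K #>\<^bsub>F\<^esub> w = K"
        using h_bij unfolding \<theta>_def bij_betw_def inj_on_def by (metis comp_apply)
      then show ?thesis
        using F.coset_join1[OF _ w K.subgroup_axioms] F.coset_join2[OF w K.subgroup_axioms] by blast
    qed
    then show ?thesis
      using K.subset by (auto simp: kernel_def)
  qed
  ultimately show ?thesis
    using subgroup_finitely_L_presented[OF assms(1) pres] \<theta> assms(3,4)
    unfolding F_def K_def by blast
qed

end
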